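(* Let $C$ be the set of rational Cauchy sequences, with the closeness relation $\sim$, the elements $0_C,1_C$, the operations $+,\cdot$ and the relation $<$ defined in the context. Then the structure $(C,\,0_C,\,1_C,\,+,\,\cdot,\,<)$ is an ordered field congruent to the closeness relation $\sim$ (in the sense defined in the context).
   Context: Here $\mathbb{N}=\{1,2,3,\dots\}$, and $k,l,m,n,n_0,\dots$ range over $\mathbb{N}$. A sequence $(a_n)=(a_n)_{n\in\mathbb{N}}$ in $\mathbb{Q}$ is Cauchy if $\forall k\,\exists n_0\,(m,n\ge n_0\Rightarrow |a_m-a_n|\le 1/k)$. Let $C$ be the set of all Cauchy sequences in $\mathbb{Q}$ (two elements of $C$ are equal only if they are equal as sequences; no quotient is taken). The closeness relation $\sim$ on $C$ is the equivalence relation $(a_n)\sim(b_n)\iff \forall k\,\exists n_0\,(n\ge n_0\Rightarrow |a_n-b_n|\le 1/k)$. Put $0_C:=(0,0,\dots)$, $1_C:=(1,1,\dots)$, $(a_n)+(b_n):=(a_n+b_n)$, $(a_n)\cdot(b_n):=(a_nb_n)$, and $(a_n)<(b_n)\iff \exists k\,\exists n_0\,(n\ge n_0\Rightarrow a_n<b_n-1/k)$. Let $X$ be a nonempty set with an equivalence relation $\sim$. A binary operation $+$ on $X$ is congruent to $\sim$ if $a\sim a'$ and $b\sim b'$ imply $a+b\sim a'+b'$ for all $a,a',b,b'\in X$. A binary relation $A$ on $X$ is congruent to $\sim$ if $a\sim a'$ and $b\sim b'$ imply ($aAb\iff a'Ab'$) for all $a,a',b,b'\in X$. An ordered field (on $X$)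 congruent to $\sim$ is a six-tuple $(X,0_X,1_X,+,\cdot,<)$ such that: (1) $(X,0_X,1_X,+,\cdot)$ is a commutative ring with identity (ring axioms hold with genuine equality $=$); (2) the operations $+$ and $\cdot$ are congruent to $\sim$; (3) $<$ is an irreflexive and transitive relation on $X$ that is congruent to $\sim$; (4) for all $a,b,c\in X$: $a<b\Rightarrow a+c<b+c$, and ($a>0_X$ and $b>0_X$) $\Rightarrow a\cdot b>0_X$; (5) (weak multiplicative inverses) for every $a\in X$ with $a\not\sim 0_X$ there is $b\in X$ with $a\cdot b\sim 1_X$; (6) (weak trichotomy) for all $a,b\in X$: $a<b$ or $b<a$ or $a\sim b$. *)

theory Defs
  imports Complex_Main "HOL-Algebra.Ring"
begin

definition op_congruent :: "'a set \<Rightarrow> 'a rel \<Rightarrow> ('a \<Rightarrow> 'a \<Rightarrow> 'a) \<Rightarrow> bool" where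
  "op_congruent X R f \<longleftrightarrow>
     (\<forall>a\<in>X. \<forall>a'\<in>X. \<forall>b\<in>X. \<forall>b'\<in>X.
        (a, a') \<in> R \<longrightarrow> (b, b') \<in> R \<longrightarrow> (f a b, f a' b') \<in> R)"

definition rel_congruent :: "'a set \<Rightarrow> 'a rel \<Rightarrow> ('a \<Rightarrow> 'a \<Rightarrow> bool) \<Rightarrow> bool" where
  "rel_congruent X R A \<longleftrightarrow>
     (\<forall>a\<in>X. \<forall>a'\<in>X. \<forall>b\<in>X. \<forall>b'\<in>X.
        (a, a') \<in> R \<longrightarrow> (b, b') \<in> R \<longrightarrow> (A a b \<longleftrightarrow> A a' b'))"

record 'a ring_with_less = "'a ring" +
  lt :: "'a \<Rightarrow> 'a \<Rightarrow> bool"  (infixl \<open>\<prec>\<index>\<close> 50)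

locale ordered_field_congruent = cring F
  for F :: "('a, 'm) ring_with_less_scheme" (structure) +
  fixes R :: "'a rel"
  assumes nonempty: "carrier F \<noteq> {}"
    and equiv_R: "equiv (carrier F) R"
    and add_congruent: "op_congruent (carrier F) R (\<lambda>a b. a \<oplus> b)"
    and mult_congruent: "op_congruent (carrier F) R (\<lambda>a b. a \<otimes> b)"
    and lt_irrefl: "irreflp_on (carrier F) (\<lambda>a b. a \<prec> b)"
    and lt_trans: "transp_on (carrier F) (\<lambda>a b. a \<prec> b)"
    and lt_congruent: "rel_congruent (carrier F) R (\<lambda>a b. a \<prec> b)"
    and add_lt_mono:
      "\<lbrakk>a \<in> carrier F; b \<in> carrier F; c \<in> carrier F; a \<prec> b\<rbrakk> \<Longrightarrow> a \<oplus> c \<prec> b \<oplus> c"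
    and mult_pos:
      "\<lbrakk>a \<in> carrier F; b \<in> carrier F; \<zero> \<prec> a; \<zero> \<prec> b\<rbrakk> \<Longrightarrow> \<zero> \<prec> a \<otimes> b"
    and weak_inverse:
      "\<lbrakk>a \<in> carrier F; (a, \<zero>) \<notin> R\<rbrakk> \<Longrightarrow> \<exists>b\<in>carrier F. (a \<otimes> b, \<one>) \<in> R"
    and weak_trichotomy:
      "\<lbrakk>a \<in> carrier F; b \<in> carrier F\<rbrakk> \<Longrightarrow> a \<prec> b \<or> b \<prec> a \<or> (a, b) \<in> R"

text \<open>Index set and parameters range over the positive integers. A sequence is a function on
  \<open>{1..}\<close> that is \<open>undefined\<close> at \<open>0\<close>, so that HOL equality is equality of sequences.\<close>

definition cauchy_seqs :: "(nat \<Rightarrow> rat) set" where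
  "cauchy_seqs =
     {a \<in> {1..} \<rightarrow>\<^sub>E UNIV.
        \<forall>k\<ge>1. \<exists>n0\<ge>1. \<forall>m\<ge>n0. \<forall>n\<ge>n0. \<bar>a m - a n\<bar> \<le> 1 / rat_of_nat k}"

definition closeness :: "(nat \<Rightarrow> rat) rel" where
  "closeness =
     {(a, b). a \<in> cauchy_seqs \<and> b \<in> cauchy_seqs \<and>
        (\<forall>k\<ge>1. \<exists>n0\<ge>1. \<forall>n\<ge>n0. \<bar>a n - b n\<bar> \<le> 1 / rat_of_nat k)}"

definition seq_less :: "(nat \<Rightarrow> rat) \<Rightarrow> (nat \<Rightarrow> rat) \<Rightarrow> bool" where
  "seq_less a b \<longleftrightarrow> (\<exists>k\<ge>1. \<exists>n0\<ge>1. \<forall>n\<ge>n0. a n < b n - 1 / rat_of_nat k)"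

definition cauchy_structure :: "(nat \<Rightarrow> rat) ring_with_less" where
  "cauchy_structure =
     \<lparr>carrier = cauchy_seqs,
      mult = (\<lambda>a b. \<lambda>n\<in>{1..}. a n * b n),
      one = (\<lambda>n\<in>{1..}. 1),
      zero = (\<lambda>n\<in>{1..}. 0),
      add = (\<lambda>a b. \<lambda>n\<in>{1..}. a n + b n),
      lt = seq_less\<rparr>"

end

theory Submission
  imports Defs
begin

text \<open>A rational sequence is Cauchy iff it converges in the reals. Under \<open>a \<mapsto> lim a\<close> closeness
  becomes equality of limits, \<open>seq_less\<close> becomes \<open><\<close> between limits, and the operations become those
  of the reals. Hence the axioms involving \<open>\<sim>\<close> or \<open><\<close> are pulled back from the ordered field of
  reals; only the commutative ring axioms, which hold with genuine equality, are checked
  pointwise.\<close>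

lemma ordered_field_congruent_vimageI:
  fixes F :: "('a, 'm) ring_with_less_scheme" (structure)
    and v :: "'a \<Rightarrow> 'k::linordered_field"
  assumes "cring F"
    and v_add: "\<And>a b. \<lbrakk>a \<in> carrier F; b \<in> carrier F\<rbrakk> \<Longrightarrow> v (a \<oplus> b) = v a + v b"
    and v_mult: "\<And>a b. \<lbrakk>a \<in> carrier F; b \<in> carrier F\<rbrakk> \<Longrightarrow> v (a \<otimes> b) = v a * v b"
    and v_one: "v \<one> = 1"
    and v_inverse: "\<And>a. \<lbrakk>a \<in> carrier F; v a \<noteq> 0\<rbrakk> \<Longrightarrow> \<exists>b\<in>carrier F. v b = inverse (v a)"
    and R_iff: "\<And>a b. (a, b) \<in> R \<longleftrightarrow> a \<in> carrier F \<and> b \<in> carrier F \<and> v a = v b"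
    and lt_iff: "\<And>a b. \<lbrakk>a \<in> carrier F; b \<in> carrier F\<rbrakk> \<Longrightarrow> a \<prec> b \<longleftrightarrow> v a < v b"
  shows "ordered_field_congruent F R"
proof -
  interpret cring F by fact
  have v_zero: "v \<zero> = 0"
    using v_add[of \<zero> \<zero>] by simp
  show ?thesis
  proof unfold_locales
    show "carrier F \<noteq> {}"
      using one_closed by blast
    show "equiv (carrier F) R"
      by (auto simp: R_iff intro!: equivI refl_onI symI transI)
    show "op_congruent (carrier F) R (\<lambda>a b. a \<oplus> b)"
      by (simp add: op_congruent_def R_iff v_add)
    show "op_congruent (carrier F) R (\<lambda>a b. a \<otimes> b)"
      by (simp add: op_congruent_def R_iff v_mult)
    show "irreflp_on (carrier F) (\<lambda>a b. a \<prec> b)"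
      by (simp add: irreflp_on_def lt_iff)
    show "transp_on (carrier F) (\<lambda>a b. a \<prec> b)"
      by (auto simp: transp_on_def lt_iff)
    show "rel_congruent (carrier F) R (\<lambda>a b. a \<prec> b)"
      by (simp add: rel_congruent_def R_iff lt_iff)
  next
    fix a assume a: "a \<in> carrier F" "(a, \<zero>) \<notin> R"
    then have "v a \<noteq> 0"
      by (simp add: R_iff v_zero)
    with a(1) obtain b where b: "b \<in> carrier F" "v b = inverse (v a)"
      using v_inverse by blast
    with a(1) \<open>v a \<noteq> 0\<close> have "(a \<otimes> b, \<one>) \<in> R"
      by (simp add: R_iff v_mult v_one)
    with b(1) show "\<exists>b\<in>carrier F. (a \<otimes> b, \<one>) \<in> R" ..
  qed (auto simp: R_iff lt_iff v_add v_mult v_zero)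
qed

lemma cring_pointwiseI:
  fixes F :: "('i \<Rightarrow> 'a::comm_ring_1, 'm) ring_scheme" (structure)
  assumes carrier: "carrier F \<subseteq> extensional I"
    and zero: "\<zero> = (\<lambda>i\<in>I. 0)" and one: "\<one> = (\<lambda>i\<in>I. 1)"
    and add: "\<And>f g. f \<oplus> g = (\<lambda>i\<in>I. f i + g i)"
    and mult: "\<And>f g. f \<otimes> g = (\<lambda>i\<in>I. f i * g i)"
    and zero_closed: "\<zero> \<in> carrier F" and one_closed: "\<one> \<in> carrier F"
    and add_closed: "\<And>f g. \<lbrakk>f \<in> carrier F; g \<in> carrier F\<rbrakk> \<Longrightarrow> f \<oplus> g \<in> carrier F"
    and mult_closed: "\<And>f g. \<lbrakk>f \<in> carrier F; g \<in> carrier F\<rbrakk> \<Longrightarrow> f \<otimes> g \<in> carrier F"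
    and uminus_closed: "\<And>f. f \<in> carrier F \<Longrightarrow> (\<lambda>i\<in>I. - f i) \<in> carrier F"
  shows "cring F"
proof (rule cringI)
  note ring_ops = zero one add mult
  have restrict_eq: "(\<lambda>i\<in>I. f i) = f" if "f \<in> carrier F" for f
    using that carrier by (intro extensional_restrict) blast
  show "abelian_group F"
  proof (rule abelian_groupI)
    fix f assume "f \<in> carrier F"
    then have "(\<lambda>i\<in>I. - f i) \<in> carrier F"
      by (rule uminus_closed)
    moreover have "(\<lambda>i\<in>I. - f i) \<oplus> f = \<zero>"
      by (auto simp: ring_ops)
    ultimately show "\<exists>g\<in>carrier F. g \<oplus> f = \<zero>"
      by blast
  qed (use zero_closed add_closed in
      \<open>auto simp: ring_ops restrict_eq add_ac cong: restrict_cong\<close>)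
  show "comm_monoid F"
    by (rule comm_monoidI) (use one_closed mult_closed in
      \<open>auto simp: ring_ops restrict_eq mult_ac cong: restrict_cong\<close>)
  show "(f \<oplus> g) \<otimes> h = f \<otimes> h \<oplus> g \<otimes> h" for f g h
    by (auto simp: ring_ops distrib_right)
qed

lemma ex_inverse_nat_less:
  fixes e :: "'a::archimedean_field"
  assumes "e > 0"
  shows "\<exists>k\<ge>1. 1 / of_nat k < e"
  using ex_inverse_of_nat_less[OF assms] by (auto simp: inverse_eq_divide Suc_le_eq)

lemma all_pos_iff_all_inverse_nat:
  fixes P :: "'a::archimedean_field \<Rightarrow> bool"
  assumes mono: "\<And>d e. \<lbrakk>P d; d \<le> e\<rbrakk> \<Longrightarrow> P e"
  shows "(\<forall>e>0. P e) \<longleftrightarrow> (\<forall>k\<ge>1. P (1 / of_nat k))"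
proof (intro iffI allI impI)
  fix e :: 'a assume P: "\<forall>k\<ge>1. P (1 / of_nat k)" and "e > 0"
  then obtain k where "k \<ge> 1" "1 / of_nat k < e"
    using ex_inverse_nat_less by blast
  with P mono show "P e"
    by (meson less_imp_le)
qed auto

lemma tendsto_iff_dist_le_inverse_nat:
  fixes f :: "'a \<Rightarrow> 'b::metric_space"
  shows "(f \<longlongrightarrow> l) F \<longleftrightarrow> (\<forall>k\<ge>1. \<forall>\<^sub>F x in F. dist (f x) l \<le> 1 / real k)"
proof -
  have "(f \<longlongrightarrow> l) F \<longleftrightarrow> (\<forall>e>0. \<forall>\<^sub>F x in F. dist (f x) l \<le> e)"
  proof
    assume "(f \<longlongrightarrow> l) F"
    then show "\<forall>e>0. \<forall>\<^sub>F x in F. dist (f x) l \<le> e"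
      unfolding tendsto_iff by (meson eventually_mono less_imp_le)
  next
    assume close: "\<forall>e>0. \<forall>\<^sub>F x in F. dist (f x) l \<le> e"
    show "(f \<longlongrightarrow> l) F"
    proof (rule tendstoI)
      fix e :: real assume "e > 0"
      with close have "\<forall>\<^sub>F x in F. dist (f x) l \<le> e / 2"
        using half_gt_zero by blast
      then show "\<forall>\<^sub>F x in F. dist (f x) l < e"
        by (rule eventually_mono) (use \<open>e > 0\<close> in linarith)
    qed
  qed
  also have "\<dots> \<longleftrightarrow> (\<forall>k\<ge>1. \<forall>\<^sub>F x in F. dist (f x) l \<le> 1 / real k)"
    by (rule all_pos_iff_all_inverse_nat) (auto elim: eventually_mono)
  finally show ?thesis .
qed

lemma limit_pos_iff_eventually_inverse_nat_less:
  fixes f :: "'a \<Rightarrow> 'b::{archimedean_field, linorder_topology}"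
  assumes lim: "(f \<longlongrightarrow> l) F" and "F \<noteq> bot"
  shows "0 < l \<longleftrightarrow> (\<exists>k\<ge>1. \<forall>\<^sub>F x in F. 1 / of_nat k < f x)"
proof
  assume "0 < l"
  then obtain k where "k \<ge> 1" "1 / of_nat k < l"
    using ex_inverse_nat_less by blast
  then show "\<exists>k\<ge>1. \<forall>\<^sub>F x in F. 1 / of_nat k < f x"
    using order_tendstoD(1)[OF lim] by blast
next
  assume "\<exists>k\<ge>1. \<forall>\<^sub>F x in F. 1 / of_nat k < f x"
  then obtain k where "k \<ge> 1" and less: "\<forall>\<^sub>F x in F. 1 / of_nat k < f x"
    by blast
  then have "0 < 1 / (of_nat k :: 'b)"
    by simp
  also have "\<dots> \<le> l"
    using less by (intro tendsto_lowerbound[OF lim _ \<open>F \<noteq> bot\<close>]) (auto elim: eventually_mono)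
  finally show "0 < l" .
qed

lemma Cauchy_iff_tendsto_dist:
  fixes X :: "nat \<Rightarrow> 'a::metric_space"
  shows "Cauchy X \<longleftrightarrow>
    ((\<lambda>(m, n). dist (X m) (X n)) \<longlongrightarrow> 0) (sequentially \<times>\<^sub>F sequentially)"
  unfolding Cauchy_def tendsto_iff eventually_prod_sequentially by (auto simp: dist_commute)

lemma ex_ge_iff_ex:
  fixes c :: "'a::linorder"
  assumes "\<And>M N. \<lbrakk>P M; M \<le> N\<rbrakk> \<Longrightarrow> P N"
  shows "(\<exists>N\<ge>c. P N) \<longleftrightarrow> (\<exists>N. P N)"
  using assms by (meson linear order_refl)

lemma eventually_sequentially_ge:
  "(\<exists>N\<ge>c. \<forall>n\<ge>N. P n) \<longleftrightarrow> (\<forall>\<^sub>F n in sequentially. P n)"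
  unfolding eventually_sequentially by (rule ex_ge_iff_ex) auto

lemma eventually_prod_sequentially_ge:
  "(\<exists>N\<ge>c. \<forall>m\<ge>N. \<forall>n\<ge>N. P m n) \<longleftrightarrow> (\<forall>\<^sub>F (m, n) in sequentially \<times>\<^sub>F sequentially. P m n)"
  unfolding eventually_prod_sequentially by (subst ex_ge_iff_ex) auto

abbreviation real_seq :: "(nat \<Rightarrow> rat) \<Rightarrow> nat \<Rightarrow> real" where
  "real_seq a \<equiv> \<lambda>n. of_rat (a n)"

definition real_lim :: "(nat \<Rightarrow> rat) \<Rightarrow> real" where
  "real_lim a = lim (real_seq a)"

lemma rat_le_inverse_nat_iff: "x \<le> 1 / rat_of_nat k \<longleftrightarrow> real_of_rat x \<le> 1 / real k"
  using of_rat_less_eq[of x "1 / rat_of_nat k", where 'a=real] by (simp add: of_rat_divide)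

lemma rat_less_diff_inverse_nat_iff:
  "x < y - 1 / rat_of_nat k \<longleftrightarrow> 1 / real k < real_of_rat y - real_of_rat x"
  using of_rat_less[of x "y - 1 / rat_of_nat k", where 'a=real]
  by (auto simp: of_rat_divide of_rat_diff)

lemma dist_real_of_rat: "dist (real_of_rat x) (real_of_rat y) = real_of_rat \<bar>x - y\<bar>"
  by (simp add: dist_real_def of_rat_diff flip: abs_of_rat)

lemma cauchy_seqs_iff_convergent:
  "a \<in> cauchy_seqs \<longleftrightarrow> a \<in> extensional {1..} \<and> convergent (real_seq a)"
proof -
  have "(\<forall>k\<ge>1. \<exists>n0\<ge>1. \<forall>m\<ge>n0. \<forall>n\<ge>n0. \<bar>a m - a n\<bar> \<le> 1 / rat_of_nat k) \<longleftrightarrow>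
      (\<forall>k\<ge>1. \<forall>\<^sub>F (m, n) in sequentially \<times>\<^sub>F sequentially.
        dist (real_seq a m) (real_seq a n) \<le> 1 / real k)"
    by (simp only: eventually_prod_sequentially_ge rat_le_inverse_nat_iff dist_real_of_rat)
  also have "\<dots> \<longleftrightarrow> Cauchy (real_seq a)"
    by (simp add: Cauchy_iff_tendsto_dist tendsto_iff_dist_le_inverse_nat split_def)
  also have "\<dots> \<longleftrightarrow> convergent (real_seq a)"
    by (rule Cauchy_convergent_iff)
  finally show ?thesis
    by (simp add: cauchy_seqs_def PiE_def)
qed

lemma tendsto_real_lim: "a \<in> cauchy_seqs \<Longrightarrow> real_seq a \<longlonglongrightarrow> real_lim a"
  by (simp add: cauchy_seqs_iff_convergent real_lim_def convergent_LIMSEQ_iff)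

lemma tendsto_real_lim_diff:
  assumes "a \<in> cauchy_seqs" "b \<in> cauchy_seqs"
  shows "(\<lambda>n. real_seq a n - real_seq b n) \<longlonglongrightarrow> real_lim a - real_lim b"
  using assms by (intro tendsto_diff tendsto_real_lim)

lemma closeness_iff_real_lim_eq:
  "(a, b) \<in> closeness \<longleftrightarrow> a \<in> cauchy_seqs \<and> b \<in> cauchy_seqs \<and> real_lim a = real_lim b"
proof (cases "a \<in> cauchy_seqs \<and> b \<in> cauchy_seqs")
  case True
  then have "(a, b) \<in> closeness \<longleftrightarrow>
      (\<forall>k\<ge>1. \<forall>\<^sub>F n in sequentially. dist (real_seq a n) (real_seq b n) \<le> 1 / real k)"
    by (simp only: closeness_def mem_Collect_eq case_prod_conv simp_thms
        eventually_sequentially_ge rat_le_inverse_nat_iff dist_real_of_rat)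
  also have "\<dots> \<longleftrightarrow> (\<lambda>n. real_seq a n - real_seq b n) \<longlonglongrightarrow> 0"
    by (simp add: tendsto_iff_dist_le_inverse_nat dist_norm)
  also have "\<dots> \<longleftrightarrow> real_lim a = real_lim b"
    using tendsto_real_lim_diff[of a b] True by (auto dest: LIMSEQ_unique)
  finally show ?thesis
    using True by simp
qed (auto simp: closeness_def)

lemma seq_less_iff_real_lim_less:
  assumes "a \<in> cauchy_seqs" "b \<in> cauchy_seqs"
  shows "seq_less a b \<longleftrightarrow> real_lim a < real_lim b"
proof -
  have "seq_less a b \<longleftrightarrow>
      (\<exists>k\<ge>1. \<forall>\<^sub>F n in sequentially. 1 / real k < real_seq b n - real_seq a n)"
    by (simp only: seq_less_def eventually_sequentially_ge rat_less_diff_inverse_nat_iff)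
  also have "\<dots> \<longleftrightarrow> 0 < real_lim b - real_lim a"
    using assms
    by (intro limit_pos_iff_eventually_inverse_nat_less[symmetric] tendsto_real_lim_diff
        sequentially_bot)
  finally show ?thesis
    by simp
qed

lemma cauchy_seqs_restrict:
  assumes "real_seq a \<longlonglongrightarrow> x"
  shows "restrict a {1..} \<in> cauchy_seqs" and "real_lim (restrict a {1..}) = x"
proof -
  have "\<forall>\<^sub>F n in sequentially. real_seq (restrict a {1..}) n = real_seq a n"
    using eventually_ge_at_top[of 1] by eventually_elim simp
  then have "real_seq (restrict a {1..}) \<longlonglongrightarrow> x"
    using assms by (rule tendsto_cong[THEN iffD2])
  then show "restrict a {1..} \<in> cauchy_seqs" "real_lim (restrict a {1..}) = x"
    by (auto simp: cauchy_seqs_iff_convergent real_lim_def convergent_def limI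
        simp del: restrict_apply)
qed

lemma cauchy_seqs_const:
  shows "(\<lambda>n\<in>{1..}. c) \<in> cauchy_seqs" and "real_lim (\<lambda>n\<in>{1..}. c) = of_rat c"
  by (rule cauchy_seqs_restrict, rule tendsto_const)+

lemma cauchy_seqs_uminus:
  assumes "a \<in> cauchy_seqs"
  shows "(\<lambda>n\<in>{1..}. - a n) \<in> cauchy_seqs"
proof (rule cauchy_seqs_restrict)
  show "real_seq (\<lambda>n. - a n) \<longlonglongrightarrow> - real_lim a"
    unfolding of_rat_minus by (intro tendsto_minus tendsto_real_lim assms)
qed

lemma cauchy_seqs_add:
  assumes "a \<in> cauchy_seqs" "b \<in> cauchy_seqs"
  shows "(\<lambda>n\<in>{1..}. a n + b n) \<in> cauchy_seqs"
    and "real_lim (\<lambda>n\<in>{1..}. a n + b n) = real_lim a + real_lim b"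
proof -
  have "real_seq (\<lambda>n. a n + b n) \<longlonglongrightarrow> real_lim a + real_lim b"
    unfolding of_rat_add by (intro tendsto_add tendsto_real_lim assms)
  then show "(\<lambda>n\<in>{1..}. a n + b n) \<in> cauchy_seqs"
    and "real_lim (\<lambda>n\<in>{1..}. a n + b n) = real_lim a + real_lim b"
    by (rule cauchy_seqs_restrict)+
qed

lemma cauchy_seqs_mult:
  assumes "a \<in> cauchy_seqs" "b \<in> cauchy_seqs"
  shows "(\<lambda>n\<in>{1..}. a n * b n) \<in> cauchy_seqs"
    and "real_lim (\<lambda>n\<in>{1..}. a n * b n) = real_lim a * real_lim b"
proof -
  have "real_seq (\<lambda>n. a n * b n) \<longlonglongrightarrow> real_lim a * real_lim b"
    unfolding of_rat_mult by (intro tendsto_mult tendsto_real_lim assms)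
  then show "(\<lambda>n\<in>{1..}. a n * b n) \<in> cauchy_seqs"
    and "real_lim (\<lambda>n\<in>{1..}. a n * b n) = real_lim a * real_lim b"
    by (rule cauchy_seqs_restrict)+
qed

text \<open>Entries \<open>a n = 0\<close> are harmless: there are only finitely many, and \<open>inverse 0 = 0\<close>.\<close>

lemma cauchy_seqs_inverse:
  assumes "a \<in> cauchy_seqs" "real_lim a \<noteq> 0"
  shows "(\<lambda>n\<in>{1..}. inverse (a n)) \<in> cauchy_seqs"
    and "real_lim (\<lambda>n\<in>{1..}. inverse (a n)) = inverse (real_lim a)"
proof -
  have "real_seq (\<lambda>n. inverse (a n)) \<longlonglongrightarrow> inverse (real_lim a)"
    unfolding of_rat_inverse by (intro tendsto_inverse tendsto_real_lim assms)
  then show "(\<lambda>n\<in>{1..}. inverse (a n)) \<in> cauchy_seqs"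
    and "real_lim (\<lambda>n\<in>{1..}. inverse (a n)) = inverse (real_lim a)"
    by (rule cauchy_seqs_restrict)+
qed

lemma cauchy_structure_sel:
  "carrier cauchy_structure = cauchy_seqs"
  "\<zero>\<^bsub>cauchy_structure\<^esub> = (\<lambda>n\<in>{1..}. 0)"
  "\<one>\<^bsub>cauchy_structure\<^esub> = (\<lambda>n\<in>{1..}. 1)"
  "a \<oplus>\<^bsub>cauchy_structure\<^esub> b = (\<lambda>n\<in>{1..}. a n + b n)"
  "a \<otimes>\<^bsub>cauchy_structure\<^esub> b = (\<lambda>n\<in>{1..}. a n * b n)"
  "a \<prec>\<^bsub>cauchy_structure\<^esub> b \<longleftrightarrow> seq_less a b"
  by (simp_all add: cauchy_structure_def)

lemma cring_cauchy_structure: "cring cauchy_structure"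
proof (rule cring_pointwiseI)
  show "carrier cauchy_structure \<subseteq> extensional {1..}"
    by (auto simp: cauchy_structure_sel cauchy_seqs_iff_convergent)
qed (unfold cauchy_structure_sel,
    (fact refl cauchy_seqs_const cauchy_seqs_add cauchy_seqs_mult cauchy_seqs_uminus)+)

theorem theorem3p4:
  shows "ordered_field_congruent cauchy_structure closeness"
proof (rule ordered_field_congruent_vimageI[where v = real_lim], unfold cauchy_structure_sel)
  show "cring cauchy_structure"
    by (rule cring_cauchy_structure)
  show "real_lim (\<lambda>n\<in>{1..}. 1) = 1"
    by (simp only: cauchy_seqs_const of_rat_1)
  show "\<exists>b\<in>cauchy_seqs. real_lim b = inverse (real_lim a)"
    if "a \<in> cauchy_seqs" "real_lim a \<noteq> 0" for a
    using cauchy_seqs_inverse[OF that] by blast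
qed (fact cauchy_seqs_add cauchy_seqs_mult closeness_iff_real_lim_eq
    seq_less_iff_real_lim_less)+

end
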